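(* Let $w=\{w_n\}_{n\in\mathbb{Z}}$ be a bounded sequence of non-zero complex numbers such that for any $a\in\mathbb{N}$, $$\inf\{\widetilde w(1,m)^{-1}\,\widetilde w(-j(m-a),0)^{1/j}:\ j\in\mathbb{N},\ m\geq a\}=0,$$ where $m$ ranges over integers. Then the weighted bilateral shift $T_{w,p}$ is cyclic for every $p$ with $1\leq p\leq\infty$.
   Context: All vector spaces are over $\mathbb{C}$; $\mathbb{Z}_+$ is the set of non-negative integers, $\mathbb{N}$ the set of positive integers. For integers $a\leq b$, $\widetilde w(a,b)=\prod_{j=a}^{b}|w_j|$. For a bounded sequence $w$ of non-zero complex numbers, the weighted bilateral shift $T_{w,p}$ is the bounded linear operator acting on $\ell_p(\mathbb{Z})$ if $1\leq p<\infty$, and on $c_0(\mathbb{Z})$ if $p=\infty$, defined on the canonical basis by $T_{w,p}e_n=w_ne_{n-1}$ for $n\in\mathbb{Z}$. A bounded linear operator $T$ on a Banach space $\mathcal{B}$ is cyclic if there is $x\in\mathcal{B}$ such that the linear span of $\{T^nx:n\in\mathbb{Z}_+\}$ is dense in $\mathcal{B}$. *)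

theory Defs
  imports "HOL-Analysis.Analysis" "HOL-Library.Function_Algebras"
begin

definition seq_scale :: "complex \<Rightarrow> (int \<Rightarrow> complex) \<Rightarrow> int \<Rightarrow> complex" where
  "seq_scale c x = (\<lambda>n. c * x n)"

interpretation seq: vector_space seq_scale
  by unfold_locales (auto simp: seq_scale_def fun_eq_iff algebra_simps)

text \<open>The space is \<open>\<ell>\<^sub>p(\<int>)\<close> for finite \<open>p\<close>, but \<open>c\<^sub>0(\<int>)\<close> (and not
  \<open>\<ell>\<^sub>\<infinity>(\<int>)\<close>) for \<open>p = \<infinity>\<close>. Limits along \<open>cofinite\<close> are limits at
  both ends of \<open>\<int>\<close>.\<close>

definition lp_space :: "ennreal \<Rightarrow> (int \<Rightarrow> complex) set" where
  "lp_space p = (if p = \<infinity> then {x. (x \<longlongrightarrow> 0) cofinite}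
     else {x. (\<lambda>n. norm (x n) powr enn2real p) summable_on UNIV})"

definition lp_norm :: "ennreal \<Rightarrow> (int \<Rightarrow> complex) \<Rightarrow> real" where
  "lp_norm p x = (if p = \<infinity> then (SUP n. norm (x n))
     else (\<Sum>\<^sub>\<infinity>n. norm (x n) powr enn2real p) powr (1 / enn2real p))"

definition basis_vec :: "int \<Rightarrow> int \<Rightarrow> complex" where
  "basis_vec n = (\<lambda>k. if k = n then 1 else 0)"

text \<open>The coordinate form of the bounded operator determined by \<open>e\<^sub>n \<mapsto> w\<^sub>n e\<^bsub>n-1\<^esub>\<close>;
  the formula does not depend on \<open>p\<close>. See \<open>weighted_shift_basis\<close>, \<open>weighted_shift_mem\<close>
  and \<open>weighted_shift_norm_le\<close> below.\<close>

definition weighted_shift :: "(int \<Rightarrow> complex) \<Rightarrow> (int \<Rightarrow> complex) \<Rightarrow> int \<Rightarrow> complex" where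
  "weighted_shift w x = (\<lambda>n. w (n + 1) * x (n + 1))"

definition cyclic_on_lp :: "ennreal \<Rightarrow> ((int \<Rightarrow> complex) \<Rightarrow> int \<Rightarrow> complex) \<Rightarrow> bool" where
  "cyclic_on_lp p T \<longleftrightarrow>
     (\<exists>x\<in>lp_space p. \<forall>y\<in>lp_space p. \<forall>\<epsilon>>0.
        \<exists>z\<in>seq.span (range (\<lambda>n. (T ^^ n) x)). lp_norm p (y - z) < \<epsilon>)"

definition wtilde :: "(int \<Rightarrow> complex) \<Rightarrow> int \<Rightarrow> int \<Rightarrow> real" where
  "wtilde w a b = (\<Prod>j\<in>{a..b}. norm (w j))"

lemma weighted_shift_basis:
  "weighted_shift w (basis_vec n) = seq_scale (w n) (basis_vec (n - 1))"
  by (auto simp: weighted_shift_def basis_vec_def seq_scale_def fun_eq_iff)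

lemma weighted_shift_linear: "Vector_Spaces.linear seq_scale seq_scale (weighted_shift w)"
  by unfold_locales (auto simp: weighted_shift_def seq_scale_def fun_eq_iff algebra_simps)

lemma bij_shift: "bij (\<lambda>n::int. n + 1)"
  by (rule bijI') (auto intro: exI[of _ "_ - 1"])

lemma lp_space_subspace:
  assumes "1 \<le> p"
  shows "seq.subspace (lp_space p)"
proof (cases "p = \<infinity>")
  case True
  show ?thesis
    unfolding seq.subspace_def
    using True by (auto simp: lp_space_def seq_scale_def zero_fun_def plus_fun_def
        intro!: tendsto_add_zero tendsto_mult_right_zero)
next
  case False
  define r where "r = enn2real p"
  have r: "r \<ge> 1" using assms False unfolding r_def
    by (metis enn2real_1 enn2real_mono infinity_ennreal_def less_top)
  have bd: "norm (a + b) powr r \<le> 2 powr r * (norm a powr r + norm b powr r)" for a b :: complex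
  proof -
    have "norm (a + b) \<le> 2 * max (norm a) (norm b)"
      using norm_triangle_ineq[of a b] by linarith
    then have "norm (a + b) powr r \<le> (2 * max (norm a) (norm b)) powr r"
      using r by (intro powr_mono2) auto
    also have "\<dots> = 2 powr r * max (norm a) (norm b) powr r"
      by (intro powr_mult)
    also have "\<dots> \<le> 2 powr r * (norm a powr r + norm b powr r)"
      by (intro mult_left_mono) (auto simp: max_def)
    finally show ?thesis .
  qed
  show ?thesis
    unfolding seq.subspace_def
  proof (intro conjI ballI allI)
    show "0 \<in> lp_space p" using False by (simp add: lp_space_def)
  next
    fix x y assume "x \<in> lp_space p" "y \<in> lp_space p"
    then have "(\<lambda>n. 2 powr r * (norm (x n) powr r + norm (y n) powr r)) summable_on UNIV"
      using False by (auto simp: lp_space_def r_def intro!: summable_on_cmult_right summable_on_add)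
    then have "(\<lambda>n. norm ((x + y) n) powr r) summable_on UNIV"
      by (rule summable_on_comparison_test) (auto simp: bd)
    then show "x + y \<in> lp_space p" using False by (simp add: lp_space_def r_def)
  next
    fix c :: complex and x assume "x \<in> lp_space p"
    then have "(\<lambda>n. norm c powr r * norm (x n) powr r) summable_on UNIV"
      using False by (auto simp: lp_space_def r_def intro!: summable_on_cmult_right)
    then show "seq_scale c x \<in> lp_space p"
      using False by (simp add: lp_space_def r_def seq_scale_def norm_mult powr_mult)
  qed
qed

lemma weighted_shift_lp_aux:
  fixes w x :: "int \<Rightarrow> complex"
  assumes r: "r \<ge> 0" and C: "\<And>n. norm (w n) \<le> C"
    and x: "(\<lambda>n. norm (x n) powr r) summable_on UNIV"
  shows "(\<lambda>n. norm (weighted_shift w x n) powr r) summable_on UNIV"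
    and "(\<Sum>\<^sub>\<infinity>n. norm (weighted_shift w x n) powr r) \<le> C powr r * (\<Sum>\<^sub>\<infinity>n. norm (x n) powr r)"
proof -
  have C0: "C \<ge> 0" using norm_ge_zero C by (rule order_trans)
  have bd: "norm (weighted_shift w x n) powr r \<le> C powr r * norm (x (n + 1)) powr r" for n
  proof -
    have "norm (weighted_shift w x n) \<le> C * norm (x (n + 1))"
      by (simp add: weighted_shift_def norm_mult C mult_right_mono)
    then have "norm (weighted_shift w x n) powr r \<le> (C * norm (x (n + 1))) powr r"
      using r by (intro powr_mono2) auto
    then show ?thesis by (simp add: powr_mult)
  qed
  have "(\<lambda>n. norm (x (n + 1)) powr r) summable_on UNIV"
    using x summable_on_reindex_bij_betw[OF bij_shift, of "\<lambda>n. norm (x n) powr r"] by simp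
  then have s: "(\<lambda>n. C powr r * norm (x (n + 1)) powr r) summable_on UNIV"
    by (rule summable_on_cmult_right)
  then show s': "(\<lambda>n. norm (weighted_shift w x n) powr r) summable_on UNIV"
    by (rule summable_on_comparison_test) (auto simp: bd)
  have "(\<Sum>\<^sub>\<infinity>n. norm (weighted_shift w x n) powr r) \<le> (\<Sum>\<^sub>\<infinity>n. C powr r * norm (x (n + 1)) powr r)"
    by (rule infsum_mono[OF s' s]) (rule bd)
  also have "\<dots> = C powr r * (\<Sum>\<^sub>\<infinity>n. norm (x (n + 1)) powr r)"
    by (rule infsum_cmult_right')
  also have "(\<Sum>\<^sub>\<infinity>n. norm (x (n + 1)) powr r) = (\<Sum>\<^sub>\<infinity>n. norm (x n) powr r)"
    using infsum_reindex_bij_betw[OF bij_shift, of "\<lambda>n. norm (x n) powr r"] by simp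
  finally show "(\<Sum>\<^sub>\<infinity>n. norm (weighted_shift w x n) powr r) \<le> C powr r * (\<Sum>\<^sub>\<infinity>n. norm (x n) powr r)" .
qed

lemma weighted_shift_mem:
  assumes "bounded (range w)" "x \<in> lp_space p"
  shows "weighted_shift w x \<in> lp_space p"
proof -
  obtain C where C: "\<And>n. norm (w n) \<le> C" using assms(1) by (auto simp: bounded_iff)
  show ?thesis
  proof (cases "p = \<infinity>")
    case True
    have "filterlim (\<lambda>n::int. n + 1) cofinite cofinite"
      unfolding filterlim_iff eventually_cofinite
    proof (intro allI impI)
      fix P :: "int \<Rightarrow> bool" assume "finite {x. \<not> P x}"
      then have "finite ((\<lambda>n. n + 1) -` {x. \<not> P x})"
        by (rule finite_vimageI) (rule bij_is_inj[OF bij_shift])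
      then show "finite {n. \<not> P (n + 1)}" by (simp add: vimage_def)
    qed
    moreover have "(x \<longlongrightarrow> 0) cofinite" using True assms(2) by (simp add: lp_space_def)
    ultimately have "((\<lambda>n. x (n + 1)) \<longlongrightarrow> 0) cofinite"
      using filterlim_compose by blast
    moreover have "Bfun (\<lambda>n. w (n + 1)) cofinite"
      using C by (intro BfunI[of _ C]) auto
    ultimately have "((\<lambda>n. w (n + 1) * x (n + 1)) \<longlongrightarrow> 0) cofinite"
      unfolding tendsto_Zfun_iff diff_zero
      by (intro bounded_bilinear.Bfun_prod_Zfun[OF bounded_bilinear_mult])
    then show ?thesis using True by (simp add: lp_space_def weighted_shift_def)
  next
    case False
    with assms(2) weighted_shift_lp_aux(1)[OF _ C, of "enn2real p" x] show ?thesis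
      by (auto simp: lp_space_def)
  qed
qed

lemma weighted_shift_norm_le:
  assumes "1 \<le> p" "\<And>n. norm (w n) \<le> C" "x \<in> lp_space p"
  shows "lp_norm p (weighted_shift w x) \<le> C * lp_norm p x"
proof (cases "p = \<infinity>")
  case True
  have "(x \<longlongrightarrow> 0) cofinite" using True assms(3) by (simp add: lp_space_def)
  then have "\<forall>\<^sub>F n in cofinite. norm (x n) < 1"
    using tendstoD[of x 0 cofinite 1] by (simp add: dist_norm)
  then have fin: "finite {n. \<not> norm (x n) < 1}" by (simp add: eventually_cofinite)
  have "bdd_above (range (\<lambda>n. norm (x n)))"
  proof (rule bdd_aboveI2)
    fix n
    show "norm (x n) \<le> 1 + (\<Sum>k\<in>{n. \<not> norm (x n) < 1}. norm (x k))"
    proof (cases "norm (x n) < 1")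
      case True
      then show ?thesis
        using sum_nonneg[of "{n. \<not> norm (x n) < 1}" "\<lambda>k. norm (x k)"] by simp
    next
      case False
      then show ?thesis using member_le_sum[of n "{n. \<not> norm (x n) < 1}" "\<lambda>k. norm (x k)"] fin by simp
    qed
  qed
  then have le: "norm (x n) \<le> (SUP n. norm (x n))" for n by (rule cSUP_upper2[of _ _ n]) auto
  have C0: "C \<ge> 0" using norm_ge_zero assms(2) by (rule order_trans)
  have "(SUP n. norm (weighted_shift w x n)) \<le> C * (SUP n. norm (x n))"
    by (rule cSUP_least) (auto simp: weighted_shift_def norm_mult intro!: mult_mono assms(2) le C0)
  then show ?thesis using True by (simp add: lp_norm_def)
next
  case False
  define r where "r = enn2real p"
  have r: "r \<ge> 1" using assms False unfolding r_def
    by (metis enn2real_1 enn2real_mono infinity_ennreal_def less_top)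
  have C0: "C \<ge> 0" using norm_ge_zero assms(2) by (rule order_trans)
  have "(\<Sum>\<^sub>\<infinity>n. norm (weighted_shift w x n) powr r) \<le> C powr r * (\<Sum>\<^sub>\<infinity>n. norm (x n) powr r)"
    using weighted_shift_lp_aux(2)[OF _ assms(2), of r x] r assms(3) False
    by (simp add: lp_space_def r_def)
  then have "(\<Sum>\<^sub>\<infinity>n. norm (weighted_shift w x n) powr r) powr (1 / r)
      \<le> (C powr r * (\<Sum>\<^sub>\<infinity>n. norm (x n) powr r)) powr (1 / r)"
    using r by (intro powr_mono2) (auto intro: infsum_nonneg)
  also have "\<dots> = C * (\<Sum>\<^sub>\<infinity>n. norm (x n) powr r) powr (1 / r)"
    using r C0 by (simp add: powr_mult powr_powr infsum_nonneg)
  finally show ?thesis using False by (simp add: lp_norm_def r_def)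
qed

end

theory Submission
  imports Defs "HOL-Computational_Algebra.Polynomial"
begin

text \<open>
  Put \<open>u\<^sub>n = e\<^sub>n / (w\<^sub>1 \<cdots> w\<^sub>n)\<close> for \<open>n \<ge> 0\<close> and \<open>u\<^bsub>-n\<^esub> = T\<^sup>n e\<^sub>0\<close>, so that \<open>T u\<^sub>n = u\<^bsub>n-1\<^esub>\<close> for
  every \<open>n\<close>. Then \<open>wtilde(1,m)\<^sup>-\<^sup>1 = \<parallel>u\<^sub>m\<parallel>\<close> and \<open>wtilde(-k,0) = \<parallel>u\<^bsub>-k-1\<^esub>\<parallel>\<close> for \<open>k \<ge> 0\<close>, so the hypothesis makes
  \<open>\<parallel>u\<^sub>m\<parallel>\<^sup>j \<parallel>u\<^bsub>-j(m-a)-1\<^esub>\<parallel>\<close> smaller than \<open>\<theta>\<^sup>j\<close> for suitable \<open>j\<close> and \<open>m \<ge> a\<close>, whatever \<open>a\<close> and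
  \<open>\<theta> > 0\<close> are. Every finitely supported vector is \<open>q(T) u\<^sub>a\<close> for some
  polynomial \<open>q\<close> and some \<open>a\<close>, and the whole proof rests on one perturbation of such a vector. Take
  \<open>m > a\<close> and a small multiple \<open>\<delta> u\<^sub>m\<close> of a vector far to the right. Since
  \<open>u\<^sub>a = T\<^bsup>m-a\<^esup> u\<^sub>m\<close>, the perturbed vector is
  \<open>q(T) u\<^sub>a + \<delta> u\<^sub>m = \<delta> (1 - R)(T) u\<^sub>m\<close> with \<open>R = - X\<^bsup>m-a\<^esup> q / \<delta>\<close>.
  The polynomial \<open>P = X\<^bsup>m-a\<^esup> (1 + R + \<cdots> + R\<^bsup>j-1\<^esup>) / \<delta>\<close> is a truncated geometric series inverting
  \<open>\<delta>(1 - R)\<close>, so \<open>P(T)\<close> sends the perturbed vector to \<open>u\<^sub>a - R\<^sup>j(T) u\<^sub>a\<close>. The error is, up to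
  sign, \<open>\<delta>\<^bsup>-j\<^esup> q\<^sup>j(T) u\<^bsub>a-j(m-a)\<^esub>\<close>. If \<open>\<delta>\<close> is chosen with \<open>\<parallel>\<delta> u\<^sub>m\<parallel> = r\<close> fixed, its size is
  at most \<open>(C \<parallel>u\<^sub>m\<parallel>)\<^sup>j \<parallel>u\<^bsub>-j(m-2a-1)-1\<^esub>\<parallel>\<close> with \<open>C\<close> independent of \<open>j\<close> and \<open>m\<close>, and the
  hypothesis makes this small (\<open>geometric_perturbation\<close>).

  Since \<open>P(T)\<close> is bounded, all vectors in a small ball around the perturbed vector are still sent
  close to \<open>u\<^sub>a\<close>, and powers of \<open>T\<close> carry this over to all \<open>u\<^sub>k\<close> with \<open>\<bar>k\<bar> \<le> N < a\<close>
  (\<open>approximation_stage\<close>). Repeating this for \<open>N = 0, 1, 2, \<dots>\<close> with nested balls yields a vector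
  \<open>x\<close> whose orbit spans a space with every \<open>u\<^sub>k\<close> in its closure
  (\<open>l1_vector_approximating_orbit_vecs\<close>).

  All estimates are made in the norm of \<open>\<ell>\<^sub>1\<close>. It dominates the norm of \<open>\<ell>\<^sub>p\<close> and of \<open>c\<^sub>0\<close>, and
  finitely supported vectors are dense there, so a single \<open>x\<close> is cyclic for all \<open>p\<close> at once.
\<close>

section \<open>Bounds on the \<open>\<ell>\<^sub>1\<close> norm\<close>

text \<open>Membership in \<open>\<ell>\<^sub>1\<close> together with a bound on the norm. Quantifying over finite sums keeps
  summability out of the estimates and makes the bound stable under pointwise limits.\<close>

definition l1_bound :: "(int \<Rightarrow> complex) \<Rightarrow> real \<Rightarrow> bool" where
  "l1_bound x s \<longleftrightarrow> (\<forall>F. finite F \<longrightarrow> (\<Sum>n\<in>F. norm (x n)) \<le> s)"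

lemma l1_boundI: "(\<And>F. finite F \<Longrightarrow> (\<Sum>n\<in>F. norm (x n)) \<le> s) \<Longrightarrow> l1_bound x s"
  by (simp add: l1_bound_def)

lemma l1_boundD: "l1_bound x s \<Longrightarrow> finite F \<Longrightarrow> (\<Sum>n\<in>F. norm (x n)) \<le> s"
  by (simp add: l1_bound_def)

lemma l1_bound_nonneg: "l1_bound x s \<Longrightarrow> 0 \<le> s"
  using l1_boundD[of x s "{}"] by simp

lemma l1_bound_component: "l1_bound x s \<Longrightarrow> norm (x n) \<le> s"
  using l1_boundD[of x s "{n}"] by simp

lemma l1_bound_mono: "l1_bound x s \<Longrightarrow> s \<le> t \<Longrightarrow> l1_bound x t"
  by (meson l1_bound_def order_trans)

lemma l1_bound_zero: "l1_bound 0 0"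
  by (simp add: l1_bound_def)

lemma l1_bound_add:
  assumes "l1_bound x s" "l1_bound y t"
  shows "l1_bound (x + y) (s + t)"
proof (rule l1_boundI)
  fix F :: "int set" assume F: "finite F"
  have "(\<Sum>n\<in>F. norm ((x + y) n)) \<le> (\<Sum>n\<in>F. norm (x n) + norm (y n))"
    by (intro sum_mono) (simp add: norm_triangle_ineq)
  also have "\<dots> \<le> s + t"
    using l1_boundD[OF assms(1) F] l1_boundD[OF assms(2) F] by (simp add: sum.distrib)
  finally show "(\<Sum>n\<in>F. norm ((x + y) n)) \<le> s + t" .
qed

lemma l1_bound_scale: "l1_bound x s \<Longrightarrow> l1_bound (seq_scale c x) (norm c * s)"
  by (auto simp: l1_bound_def seq_scale_def norm_mult simp flip: sum_distrib_left
      intro!: mult_left_mono)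

lemma l1_bound_minus_commute: "l1_bound (x - y) s \<longleftrightarrow> l1_bound (y - x) s"
  by (simp add: l1_bound_def norm_minus_commute)

lemma l1_bound_basis: "l1_bound (seq_scale c (basis_vec n)) (norm c)"
  by (rule l1_boundI) (auto simp: seq_scale_def basis_vec_def norm_mult if_distrib sum.delta' cong: if_cong)

lemma l1_bound_shift:
  assumes "\<And>n. norm (w n) \<le> M" "l1_bound x s"
  shows "l1_bound (weighted_shift w x) (M * s)"
proof (rule l1_boundI)
  fix F :: "int set" assume F: "finite F"
  have "0 \<le> M" using norm_ge_zero assms(1) by (rule order_trans)
  have "(\<Sum>n\<in>F. norm (weighted_shift w x n)) \<le> (\<Sum>n\<in>F. M * norm (x (n + 1)))"
    by (intro sum_mono) (simp add: weighted_shift_def norm_mult assms(1) mult_right_mono)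
  also have "\<dots> = M * (\<Sum>n\<in>(\<lambda>n. n + 1) ` F. norm (x n))"
    by (simp add: sum.reindex sum_distrib_left)
  also have "\<dots> \<le> M * s"
    using F \<open>0 \<le> M\<close> by (intro mult_left_mono l1_boundD[OF assms(2)]) auto
  finally show "(\<Sum>n\<in>F. norm (weighted_shift w x n)) \<le> M * s" .
qed

lemma l1_bound_shift_power:
  assumes "\<And>n. norm (w n) \<le> M" "l1_bound x s"
  shows "l1_bound ((weighted_shift w ^^ k) x) (M ^ k * s)"
proof (induction k)
  case (Suc k)
  from l1_bound_shift[OF assms(1) Suc] show ?case by (simp add: mult.assoc)
qed (simp add: assms(2))

text \<open>Completeness of \<open>\<ell>\<^sub>1\<close> in the form needed here: as the radii are at least halved and each centre
  moves by at most half of the old radius, the balls are nested, and the pointwise limit of the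
  centres lies in all of them.\<close>

lemma nested_l1_balls:
  fixes f :: "nat \<Rightarrow> int \<Rightarrow> complex"
  assumes step: "\<And>n. l1_bound (f (Suc n) - f n) (r n / 2)"
    and half: "\<And>n. r (Suc n) \<le> r n / 2"
  shows "\<exists>x. \<forall>n. l1_bound (x - f n) (r n)"
proof -
  have r0: "0 \<le> r n" for n
    using l1_bound_nonneg[OF step[of n]] by simp
  have later: "l1_bound (f (n + k) - f n) (r n)" for n k
  proof (induction k arbitrary: n)
    case 0
    show "l1_bound (f (n + 0) - f n) (r n)"
      using l1_bound_mono[OF l1_bound_zero r0] by simp
  next
    case (Suc k)
    have "l1_bound ((f (Suc n + k) - f (Suc n)) + (f (Suc n) - f n)) (r (Suc n) + r n / 2)"
      by (rule l1_bound_add[OF Suc step])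
    then have "l1_bound (f (Suc n + k) - f n) (r (Suc n) + r n / 2)"
      by (simp add: algebra_simps)
    from l1_bound_mono[OF this, of "r n"] half[of n]
    show "l1_bound (f (n + Suc k) - f n) (r n)" by simp
  qed
  have small: "r n \<le> r 0 * (1 / 2) ^ n" for n
  proof (induction n)
    case (Suc n)
    then show ?case using half[of n] by simp
  qed simp
  have "(\<lambda>n. r 0 * (1 / 2) ^ n) \<longlonglongrightarrow> 0"
    by (intro tendsto_mult_right_zero LIMSEQ_power_zero) simp
  then have lim: "r \<longlonglongrightarrow> 0"
    by (rule tendsto_sandwich[of "\<lambda>_. 0", rotated -1]) (auto simp: r0 small)
  have "convergent (\<lambda>k. f k i)" for i
  proof (rule Cauchy_convergent, rule metric_CauchyI)
    fix e :: real assume "0 < e"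
    then obtain N where N: "r N < e / 2"
      using order_tendstoD(2)[OF lim, of "e / 2"] by (auto simp: eventually_sequentially)
    have near: "norm (f k i - f N i) < e / 2" if "k \<ge> N" for k
      using l1_bound_component[OF later[of N "k - N"], of i] N that by simp
    show "\<exists>N. \<forall>m\<ge>N. \<forall>n\<ge>N. dist (f m i) (f n i) < e"
    proof (intro exI[of _ N] allI impI)
      fix m n assume "N \<le> m" "N \<le> n"
      then show "dist (f m i) (f n i) < e"
        using near[of m] near[of n] dist_triangle_half_l[of "f m i" "f N i" e "f n i"]
        by (simp add: dist_norm norm_minus_commute)
    qed
  qed
  then obtain x where x: "\<And>i. (\<lambda>k. f k i) \<longlonglongrightarrow> x i"
    unfolding convergent_def by metis
  have "l1_bound (x - f n) (r n)" for n
  proof (rule l1_boundI)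
    fix F :: "int set" assume F: "finite F"
    have "(\<lambda>k. \<Sum>i\<in>F. norm (f k i - f n i)) \<longlonglongrightarrow> (\<Sum>i\<in>F. norm (x i - f n i))"
      by (intro tendsto_intros x)
    moreover have "\<forall>\<^sub>F k in sequentially. (\<Sum>i\<in>F. norm (f k i - f n i)) \<le> r n"
      using eventually_ge_at_top[of n]
    proof eventually_elim
      case (elim k)
      then show ?case using l1_boundD[OF later[of n "k - n"] F] by simp
    qed
    ultimately show "(\<Sum>i\<in>F. norm ((x - f n) i)) \<le> r n"
      by (simp add: tendsto_upperbound)
  qed
  then show ?thesis by blast
qed

section \<open>From \<open>\<ell>\<^sub>1\<close> to \<open>\<ell>\<^sub>p\<close>\<close>

text \<open>Since \<open>\<bar>x\<^sub>n\<bar> \<le> s\<close>, one has \<open>\<bar>x\<^sub>n\<bar>\<^sup>r \<le> \<bar>x\<^sub>n\<bar> s\<^bsup>r-1\<^esup>\<close>; summing gives the comparison of the two norms.\<close>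

lemma powr_sum_le_l1_bound:
  assumes "l1_bound x s" "1 \<le> r" "finite F"
  shows "(\<Sum>n\<in>F. norm (x n) powr r) \<le> s powr r"
proof -
  have split: "t powr r = t * t powr (r - 1)" if "0 \<le> t" for t :: real
    using that by (cases "t = 0") (auto simp: powr_mult_base)
  have "(\<Sum>n\<in>F. norm (x n) powr r) \<le> (\<Sum>n\<in>F. norm (x n) * s powr (r - 1))"
  proof (intro sum_mono)
    fix n
    show "norm (x n) powr r \<le> norm (x n) * s powr (r - 1)"
      using assms(2) l1_bound_component[OF assms(1), of n]
      by (auto simp: split intro!: mult_left_mono powr_mono2)
  qed
  also have "\<dots> \<le> s * s powr (r - 1)"
    using l1_boundD[OF assms(1,3)] by (simp flip: sum_distrib_right add: mult_right_mono)
  also have "\<dots> = s powr r"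
    using split l1_bound_nonneg[OF assms(1)] by simp
  finally show ?thesis .
qed

lemma l1_bound_powr_summable:
  assumes "l1_bound x s" "1 \<le> r"
  shows "(\<lambda>n. norm (x n) powr r) summable_on UNIV"
    and "(\<Sum>\<^sub>\<infinity>n. norm (x n) powr r) \<le> s powr r"
proof -
  show *: "(\<lambda>n. norm (x n) powr r) summable_on UNIV"
    by (rule nonneg_bdd_above_summable_on)
      (auto intro!: bdd_aboveI[of _ "s powr r"] powr_sum_le_l1_bound[OF assms])
  show "(\<Sum>\<^sub>\<infinity>n. norm (x n) powr r) \<le> s powr r"
    by (rule infsum_le_finite_sums[OF *]) (rule powr_sum_le_l1_bound[OF assms])
qed

lemma enn2real_ge_1:
  assumes "1 \<le> p" "p \<noteq> \<infinity>"
  shows "1 \<le> enn2real p"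
  using assms by (metis enn2real_1 enn2real_mono infinity_ennreal_def less_top)

lemma l1_bound_mem_lp:
  assumes "l1_bound x s" "1 \<le> p"
  shows "x \<in> lp_space p"
proof (cases "p = \<infinity>")
  case True
  have "finite {n. \<not> norm (x n) < e}" if "0 < e" for e
  proof (rule ccontr)
    assume inf: "infinite {n. \<not> norm (x n) < e}"
    obtain k :: nat where k: "s < real k * e" using reals_Archimedean3[OF \<open>0 < e\<close>] by blast
    obtain F where F: "F \<subseteq> {n. \<not> norm (x n) < e}" "finite F" "card F = k"
      using infinite_arbitrarily_large[OF inf] by metis
    have "real k * e \<le> (\<Sum>n\<in>F. norm (x n))"
      unfolding F(3)[symmetric] using F(1) by (intro sum_bounded_below) auto
    then show False using l1_boundD[OF assms(1) F(2)] k by simp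
  qed
  then show ?thesis
    using True by (auto simp: lp_space_def tendsto_iff eventually_cofinite)
next
  case False
  then show ?thesis
    using l1_bound_powr_summable(1)[OF assms(1) enn2real_ge_1[OF assms(2)]]
    by (simp add: lp_space_def)
qed

definition restrict_seq :: "int set \<Rightarrow> (int \<Rightarrow> complex) \<Rightarrow> int \<Rightarrow> complex" where
  "restrict_seq F y = (\<lambda>n. if n \<in> F then y n else 0)"

text \<open>Truncations are dense, and an \<open>\<ell>\<^sub>1\<close> approximation of a truncation is an \<open>\<ell>\<^sub>p\<close> approximation of
  the original vector. The factor 4 comes from the crude inequality
  \<open>\<bar>a + b\<bar>\<^sup>r \<le> 2\<^sup>r (\<bar>a\<bar>\<^sup>r + \<bar>b\<bar>\<^sup>r)\<close>, which serves in place of Minkowski's inequality.\<close>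

lemma lp_norm_truncated_approx:
  assumes "1 \<le> p" "y \<in> lp_space p" "0 < s"
  obtains F where "finite F"
    and "\<And>z. l1_bound (restrict_seq F y - z) s \<Longrightarrow> lp_norm p (y - z) \<le> 4 * s"
proof (cases "p = \<infinity>")
  case True
  then have "finite {n. \<not> norm (y n) < s}"
    using assms(2) tendstoD[of y 0 cofinite s] assms(3)
    by (auto simp: lp_space_def eventually_cofinite)
  moreover have "lp_norm p (y - z) \<le> 4 * s"
    if z: "l1_bound (restrict_seq {n. \<not> norm (y n) < s} y - z) s" for z
  proof -
    have "norm (y n - z n) \<le> 4 * s" for n
    proof (cases "norm (y n) < s")
      case True
      then show ?thesis
        using l1_bound_component[OF z, of n] norm_triangle_ineq4[of "y n" "z n"] assms(3)
        by (simp add: restrict_seq_def)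
    next
      case False
      then show ?thesis
        using l1_bound_component[OF z, of n] assms(3) by (simp add: restrict_seq_def)
    qed
    then show ?thesis using True by (auto simp: lp_norm_def intro!: cSUP_least)
  qed
  ultimately show ?thesis by (rule that)
next
  case False
  define r where "r = enn2real p"
  have r: "1 \<le> r" unfolding r_def by (rule enn2real_ge_1[OF assms(1) False])
  have sum: "(\<lambda>n. norm (y n) powr r) summable_on UNIV"
    using assms(2) False by (simp add: lp_space_def r_def)
  have "\<forall>\<^sub>F F in finite_subsets_at_top UNIV.
      dist (\<Sum>n\<in>F. norm (y n) powr r) (\<Sum>\<^sub>\<infinity>n. norm (y n) powr r) < s powr r"
    using infsum_tendsto[OF sum] assms(3) by (intro tendstoD) auto
  then obtain F where F: "finite F"
      and close: "dist (\<Sum>n\<in>F. norm (y n) powr r) (\<Sum>\<^sub>\<infinity>n. norm (y n) powr r) < s powr r"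
    by (auto simp: eventually_finite_subsets_at_top)
  have sumF: "(\<lambda>n. norm ((y - restrict_seq F y) n) powr r) summable_on UNIV"
    by (rule summable_on_comparison_test[OF sum]) (auto simp: restrict_seq_def)
  have "(\<Sum>\<^sub>\<infinity>n. norm ((y - restrict_seq F y) n) powr r)
      = (\<Sum>\<^sub>\<infinity>n\<in>UNIV - F. norm (y n) powr r)"
    by (rule infsum_cong_neutral) (auto simp: restrict_seq_def)
  also have "\<dots> = (\<Sum>\<^sub>\<infinity>n. norm (y n) powr r) - (\<Sum>n\<in>F. norm (y n) powr r)"
    using F by (subst infsum_Diff[OF sum]) (auto simp: infsum_finite)
  finally have tail: "(\<Sum>\<^sub>\<infinity>n. norm ((y - restrict_seq F y) n) powr r) \<le> s powr r"
    using close by (simp add: dist_real_def)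
  have "lp_norm p (y - z) \<le> 4 * s" if z: "l1_bound (restrict_seq F y - z) s" for z
  proof -
    let ?a = "y - restrict_seq F y" and ?b = "restrict_seq F y - z"
    note sumb = l1_bound_powr_summable[OF z r]
    have bd: "norm ((y - z) n) powr r \<le> 2 powr r * (norm (?a n) powr r + norm (?b n) powr r)" for n
    proof -
      have "norm ((y - z) n) \<le> 2 * max (norm (?a n)) (norm (?b n))"
        using norm_triangle_ineq[of "?a n" "?b n"] by simp
      then have "norm ((y - z) n) powr r \<le> (2 * max (norm (?a n)) (norm (?b n))) powr r"
        using r by (intro powr_mono2) auto
      also have "\<dots> \<le> 2 powr r * (norm (?a n) powr r + norm (?b n) powr r)"
        unfolding powr_mult by (intro mult_left_mono) (auto simp: max_def)
      finally show ?thesis .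
    qed
    have dom: "(\<lambda>n. 2 powr r * (norm (?a n) powr r + norm (?b n) powr r)) summable_on UNIV"
      by (intro summable_on_cmult_right summable_on_add sumF sumb(1))
    have "(\<Sum>\<^sub>\<infinity>n. norm ((y - z) n) powr r)
        \<le> (\<Sum>\<^sub>\<infinity>n. 2 powr r * (norm (?a n) powr r + norm (?b n) powr r))"
      by (rule infsum_mono[OF summable_on_comparison_test[OF dom] dom]) (rule bd norm_ge_zero powr_ge_zero)+
    also have "\<dots> = 2 powr r * ((\<Sum>\<^sub>\<infinity>n. norm (?a n) powr r) + (\<Sum>\<^sub>\<infinity>n. norm (?b n) powr r))"
      by (simp only: infsum_cmult_right' infsum_add[OF sumF sumb(1)])
    also have "\<dots> \<le> 2 powr r * (2 powr r * s powr r)"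
    proof (intro mult_left_mono)
      have "(2::real) powr 1 \<le> 2 powr r" using r by (intro powr_mono) auto
      then have "2 * s powr r \<le> 2 powr r * s powr r" by (intro mult_right_mono) auto
      then show "(\<Sum>\<^sub>\<infinity>n. norm (?a n) powr r) + (\<Sum>\<^sub>\<infinity>n. norm (?b n) powr r) \<le> 2 powr r * s powr r"
        using tail sumb(2) by linarith
    qed simp
    also have "\<dots> = (4 * s) powr r"
      by (simp flip: powr_mult)
    finally have "(\<Sum>\<^sub>\<infinity>n. norm ((y - z) n) powr r) powr (1 / r) \<le> ((4 * s) powr r) powr (1 / r)"
      using r by (intro powr_mono2) (auto intro: infsum_nonneg)
    then show ?thesis
      using r assms(3) False by (simp add: lp_norm_def r_def powr_powr)
  qed
  then show ?thesis using F that by blast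
qed

section \<open>Polynomials in a weighted shift\<close>

text \<open>The action of a polynomial in the weighted shift, by Horner's scheme.\<close>

definition shift_poly :: "(int \<Rightarrow> complex) \<Rightarrow> complex poly \<Rightarrow> (int \<Rightarrow> complex) \<Rightarrow> int \<Rightarrow> complex" where
  "shift_poly w q x = fold_coeffs (\<lambda>c y. seq_scale c x + weighted_shift w y) q 0"

lemma weighted_shift_zero [simp]: "weighted_shift w 0 = 0"
  by (simp add: weighted_shift_def fun_eq_iff)

lemma weighted_shift_add: "weighted_shift w (x + y) = weighted_shift w x + weighted_shift w y"
  by (simp add: weighted_shift_def fun_eq_iff distrib_left)

lemma weighted_shift_scale: "weighted_shift w (seq_scale c x) = seq_scale c (weighted_shift w x)"
  by (simp add: weighted_shift_def seq_scale_def fun_eq_iff)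

lemma shift_poly_0 [simp]: "shift_poly w 0 x = 0"
  by (simp add: shift_poly_def)

lemma shift_poly_pCons [simp]:
  "shift_poly w (pCons c q) x = seq_scale c x + weighted_shift w (shift_poly w q x)"
  by (cases "c = 0 \<and> q = 0") (auto simp: shift_poly_def)

lemma shift_poly_1 [simp]: "shift_poly w 1 x = x"
  by (simp add: one_pCons)

lemma shift_poly_add: "shift_poly w (p + q) x = shift_poly w p x + shift_poly w q x"
  by (induction p q rule: poly_induct2)
    (simp_all add: fun_eq_iff weighted_shift_def seq_scale_def algebra_simps)

lemma shift_poly_smult: "shift_poly w (smult c q) x = seq_scale c (shift_poly w q x)"
  by (induction q) (simp_all add: fun_eq_iff weighted_shift_def seq_scale_def algebra_simps)

lemma shift_poly_mult: "shift_poly w (p * q) x = shift_poly w p (shift_poly w q x)"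
  by (induction p) (simp_all add: shift_poly_add shift_poly_smult)

lemma shift_poly_arg_add: "shift_poly w q (x + y) = shift_poly w q x + shift_poly w q y"
  by (induction q) (simp_all add: fun_eq_iff weighted_shift_def seq_scale_def algebra_simps)

lemma shift_poly_arg_diff: "shift_poly w q (x - y) = shift_poly w q x - shift_poly w q y"
  using shift_poly_arg_add[of w q "x - y" y] by (simp add: eq_diff_eq)

lemma shift_poly_monom: "shift_poly w (monom 1 k) x = (weighted_shift w ^^ k) x"
  by (induction k) (simp_all add: monom_0 monom_Suc)

lemma weighted_shift_span_orbit:
  assumes "z \<in> seq.span (range (\<lambda>n. (weighted_shift w ^^ n) x))"
  shows "weighted_shift w z \<in> seq.span (range (\<lambda>n. (weighted_shift w ^^ n) x))"
  using assms
proof (induction rule: seq.span_induct_alt)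
  case base
  show "weighted_shift w 0 \<in> seq.span (range (\<lambda>n. (weighted_shift w ^^ n) x))"
    by (simp add: seq.span_zero)
next
  case (step c y z)
  from step(1) obtain n where "y = (weighted_shift w ^^ n) x" by auto
  then have "weighted_shift w y = (weighted_shift w ^^ Suc n) x" by simp
  then have "weighted_shift w y \<in> seq.span (range (\<lambda>n. (weighted_shift w ^^ n) x))"
    by (metis rangeI seq.span_base)
  then show "weighted_shift w (seq_scale c y + z) \<in> seq.span (range (\<lambda>n. (weighted_shift w ^^ n) x))"
    using step(2) by (simp add: weighted_shift_add weighted_shift_scale seq.span_add seq.span_scale)
qed

lemma shift_poly_span_orbit:
  "shift_poly w q x \<in> seq.span (range (\<lambda>n. (weighted_shift w ^^ n) x))"
proof (induction q)
  case 0
  show "shift_poly w 0 x \<in> seq.span (range (\<lambda>n. (weighted_shift w ^^ n) x))"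
    by (simp add: seq.span_zero)
next
  case (pCons c q)
  have "x \<in> seq.span (range (\<lambda>n. (weighted_shift w ^^ n) x))"
    by (rule seq.span_base) (auto intro!: image_eqI[of _ _ 0])
  then show "shift_poly w (pCons c q) x \<in> seq.span (range (\<lambda>n. (weighted_shift w ^^ n) x))"
    using pCons by (simp add: seq.span_add seq.span_scale weighted_shift_span_orbit)
qed

lemma shift_poly_bounded:
  assumes "\<And>n. norm (w n) \<le> M"
  obtains K where "0 < K" "\<And>x s. l1_bound x s \<Longrightarrow> l1_bound (shift_poly w q x) (K * s)"
proof -
  have "0 \<le> M" using norm_ge_zero assms by (rule order_trans)
  have "\<exists>K>0. \<forall>x s. l1_bound x s \<longrightarrow> l1_bound (shift_poly w q x) (K * s)"
  proof (induction q)
    case 0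
    have "l1_bound (shift_poly w 0 x) (1 * s)" if "l1_bound x s" for x s
      using l1_bound_mono[OF l1_bound_zero l1_bound_nonneg[OF that]] by simp
    then show "\<exists>K>0. \<forall>x s. l1_bound x s \<longrightarrow> l1_bound (shift_poly w 0 x) (K * s)"
      by (intro exI[of _ 1]) simp
  next
    case (pCons c q)
    then obtain K where K: "0 < K"
      "\<And>x s. l1_bound x s \<Longrightarrow> l1_bound (shift_poly w q x) (K * s)" by auto
    have "l1_bound (shift_poly w (pCons c q) x) ((norm c + M * K + 1) * s)" if "l1_bound x s" for x s
    proof -
      have "l1_bound (shift_poly w (pCons c q) x) (norm c * s + M * (K * s))"
        using l1_bound_add[OF l1_bound_scale[OF that, of c] l1_bound_shift[OF assms K(2)[OF that]]]
        by simp
      then show ?thesis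
        by (rule l1_bound_mono) (use l1_bound_nonneg[OF that] in \<open>simp add: algebra_simps\<close>)
    qed
    then show "\<exists>K>0. \<forall>x s. l1_bound x s \<longrightarrow> l1_bound (shift_poly w (pCons c q) x) (K * s)"
      using \<open>0 \<le> M\<close> K(1) by (intro exI[of _ "norm c + M * K + 1"] conjI add_nonneg_pos) auto
  qed
  then show ?thesis using that by blast
qed

lemma shift_poly_power_bounded:
  assumes "\<And>x s. l1_bound x s \<Longrightarrow> l1_bound (shift_poly w q x) (K * s)" "l1_bound x s"
  shows "l1_bound (shift_poly w (q ^ j) x) (K ^ j * s)"
proof (induction j)
  case (Suc j)
  from assms(1)[OF Suc] show ?case by (simp add: shift_poly_mult mult.assoc)
qed (simp add: assms(2))

section \<open>The backward orbit of a basis vector\<close>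

text \<open>One of the two products is empty for each \<open>n\<close>, so the formula covers both the vectors
  \<open>e\<^sub>n / (w\<^sub>1 \<cdots> w\<^sub>n)\<close> and the vectors \<open>T\<^sup>n e\<^sub>0\<close>.\<close>

definition orbit_coeff :: "(int \<Rightarrow> complex) \<Rightarrow> int \<Rightarrow> complex" where
  "orbit_coeff w n = inverse (\<Prod>j\<in>{1..n}. w j) * (\<Prod>j\<in>{n + 1..0}. w j)"

definition orbit_vec :: "(int \<Rightarrow> complex) \<Rightarrow> int \<Rightarrow> int \<Rightarrow> complex" where
  "orbit_vec w n = seq_scale (orbit_coeff w n) (basis_vec n)"

lemma orbit_coeff_step:
  assumes "w n \<noteq> 0"
  shows "orbit_coeff w n * w n = orbit_coeff w (n - 1)"
proof (cases "1 \<le> n")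
  case True
  then have e: "{1..n} = insert n {1..n - 1}" by auto
  have "(\<Prod>j\<in>{1..n}. w j) = w n * (\<Prod>j\<in>{1..n - 1}. w j)" unfolding e by simp
  then show ?thesis using assms True by (simp add: orbit_coeff_def)
next
  case False
  then have e: "{n..0} = insert n {n + 1..0}" by auto
  have "(\<Prod>j\<in>{n..0}. w j) = w n * (\<Prod>j\<in>{n + 1..0}. w j)" unfolding e by simp
  then show ?thesis using False by (simp add: orbit_coeff_def)
qed

lemma norm_orbit_coeff: "norm (orbit_coeff w n) = inverse (wtilde w 1 n) * wtilde w (n + 1) 0"
  by (simp add: orbit_coeff_def wtilde_def norm_mult norm_inverse prod_norm)

lemma weighted_shift_orbit_vec:
  "w n \<noteq> 0 \<Longrightarrow> weighted_shift w (orbit_vec w n) = orbit_vec w (n - 1)"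
  by (simp add: orbit_vec_def weighted_shift_scale weighted_shift_basis orbit_coeff_step)

lemma weighted_shift_power_orbit_vec:
  assumes "\<And>n. w n \<noteq> 0"
  shows "(weighted_shift w ^^ k) (orbit_vec w n) = orbit_vec w (n - int k)"
  by (induction k) (simp_all add: weighted_shift_orbit_vec assms algebra_simps)

text \<open>Witnesses in place of infima: the geometric argument needs an actual pair \<open>j\<close>, \<open>m\<close> for each
  threshold \<open>\<theta>\<close>.\<close>

definition vanishing_means :: "(int \<Rightarrow> complex) \<Rightarrow> bool" where
  "vanishing_means w \<longleftrightarrow> (\<forall>a\<ge>1. \<forall>\<theta>>0. \<exists>j\<ge>1. \<exists>m\<ge>a.
     inverse (wtilde w 1 m) * wtilde w (- int j * (m - a)) 0 powr (1 / real j) < \<theta>)"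

lemma vanishing_meansD:
  assumes "vanishing_means w" "1 \<le> a" "0 < \<theta>"
  obtains j m where "1 \<le> j" "a \<le> m"
    "inverse (wtilde w 1 m) * wtilde w (- int j * (m - a)) 0 powr (1 / real j) < \<theta>"
  using assms unfolding vanishing_means_def by metis

lemma vanishing_meansI:
  assumes "\<And>a::int. a \<ge> 1 \<Longrightarrow>
      Inf {inverse (wtilde w 1 m) * wtilde w (- int j * (m - a)) 0 powr (1 / real j) | j m.
             j \<ge> 1 \<and> m \<ge> a} = 0"
  shows "vanishing_means w"
  unfolding vanishing_means_def
proof (intro allI impI)
  fix a :: int and \<theta> :: real assume a: "1 \<le> a" and \<theta>: "0 < \<theta>"
  let ?S = "{inverse (wtilde w 1 m) * wtilde w (- int j * (m - a)) 0 powr (1 / real j) | j m.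
             j \<ge> 1 \<and> m \<ge> a}"
  have "?S \<noteq> {}" by (auto intro!: exI[of _ "1::nat"] exI[of _ a])
  moreover have "Inf ?S < \<theta>" using assms[OF a] \<theta> by simp
  ultimately show "\<exists>j\<ge>1. \<exists>m\<ge>a.
      inverse (wtilde w 1 m) * wtilde w (- int j * (m - a)) 0 powr (1 / real j) < \<theta>"
    using cInf_lessD[of ?S \<theta>] by auto
qed

section \<open>Perturbation\<close>

text \<open>The truncated geometric series: \<open>P q' = X\<^sup>d (1 - R\<^sup>j)\<close> with \<open>d = m - a\<close>, where
  \<open>q' = \<delta> (1 - R)\<close> is the polynomial with
  \<open>q'(T) u\<^sub>m = q(T) u\<^sub>a + \<delta> u\<^sub>m\<close>.\<close>

lemma geometric_perturbation:
  fixes w :: "int \<Rightarrow> complex"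
  assumes nz: "\<And>n. w n \<noteq> 0" and M: "\<And>n. norm (w n) \<le> M" "1 \<le> M"
    and small: "vanishing_means w"
    and a: "1 \<le> a" and r: "0 < r" and \<epsilon>: "0 < \<epsilon>"
  obtains m q' P where "a < m"
    and "l1_bound (shift_poly w q' (orbit_vec w m) - shift_poly w q (orbit_vec w a)) r"
    and "l1_bound (shift_poly w P (shift_poly w q' (orbit_vec w m)) - orbit_vec w a) \<epsilon>"
proof -
  obtain K where K: "0 < K" "\<And>x s. l1_bound x s \<Longrightarrow> l1_bound (shift_poly w q x) (K * s)"
    using shift_poly_bounded[where w = w and q = q, OF M(1)] by metis
  \<comment> \<open>The error term lives at index \<open>a - j (m - a)\<close>, which is at most \<open>- j (m - A) - 1\<close> for every
      \<open>j \<ge> 1\<close> with this \<open>A\<close>.\<close>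
  define A where "A = 2 * a + 1"
  define C where "C = K * M ^ nat (a + 1) / r"
  have C: "0 < C" using K(1) M(2) r by (auto simp: C_def)
  \<comment> \<open>The cap at 1 ensures \<open>s\<^sup>j \<le> s\<close>.\<close>
  define s where "s = min \<epsilon> 1"
  have s: "0 < s" "s \<le> 1" "s \<le> \<epsilon>" using \<epsilon> by (auto simp: s_def)
  obtain j m where j: "1 \<le> j" and m: "A \<le> m"
    and product: "inverse (wtilde w 1 m) * wtilde w (- int j * (m - A)) 0 powr (1 / real j) < s / C"
    using vanishing_meansD[OF small, of A "s / C"] a s(1) C by (auto simp: A_def)
  define \<mu> where "\<mu> = norm (orbit_coeff w m)"
  define W where "W = wtilde w (- int j * (m - A)) 0"
  have wt_pos: "0 < wtilde w b c" for b c
    using nz by (simp add: wtilde_def prod_pos)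
  have \<mu>: "\<mu> = inverse (wtilde w 1 m)"
    using a m by (simp add: \<mu>_def norm_orbit_coeff A_def wtilde_def)
  have \<mu>0: "0 < \<mu>" and W0: "0 < W" by (simp_all add: \<mu> W_def wt_pos)
  have power_small: "(C * \<mu>) ^ j * W \<le> s"
  proof -
    have "W = (W powr (1 / real j)) ^ j"
      using W0 j by (simp add: powr_powr flip: powr_realpow)
    then have "(C * \<mu>) ^ j * W = (C * (\<mu> * W powr (1 / real j))) ^ j"
      by (metis mult.assoc power_mult_distrib)
    also have "\<dots> \<le> s ^ j"
      using product C \<mu>0 W0 by (intro power_mono) (auto simp: \<mu> W_def field_simps)
    also have "\<dots> \<le> s"
      using s j power_decreasing[of 1 j s] by simp
    finally show ?thesis .
  qed
  define d where "d = nat (m - a)"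
  have d: "int d = m - a" "m - int d = a" using a m by (auto simp: d_def A_def)
  define \<delta> where "\<delta> = complex_of_real (r / \<mu>)"
  have \<delta>: "\<delta> \<noteq> 0" "norm \<delta> = r / \<mu>" using r \<mu>0 by (auto simp: \<delta>_def norm_divide)
  define \<kappa> where "\<kappa> = - 1 / \<delta>"
  have \<kappa>: "norm \<kappa> = \<mu> / r" using \<delta>(2) by (simp add: \<kappa>_def norm_divide)
  define R where "R = smult \<kappa> (q * monom 1 d)"
  define q' where "q' = smult \<delta> (1 - R)"
  define P where "P = smult (1 / \<delta>) ((\<Sum>i<j. R ^ i) * monom 1 d)"
  have "q' = q * monom 1 d + [:\<delta>:]"
    using \<delta>(1) by (simp add: q'_def R_def \<kappa>_def smult_add_right add.commute)
  moreover have ua: "(weighted_shift w ^^ d) (orbit_vec w m) = orbit_vec w a"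
    by (simp only: weighted_shift_power_orbit_vec[OF nz] d(2))
  ultimately have q': "shift_poly w q' (orbit_vec w m)
      = shift_poly w q (orbit_vec w a) + seq_scale \<delta> (orbit_vec w m)"
    by (simp add: shift_poly_add shift_poly_mult shift_poly_monom shift_poly_smult)
  have "l1_bound (seq_scale \<delta> (orbit_vec w m)) r"
    using l1_bound_basis[of "\<delta> * orbit_coeff w m" m] \<delta>(2) \<mu>0
    by (simp add: orbit_vec_def norm_mult \<mu>_def)
  then have near: "l1_bound (shift_poly w q' (orbit_vec w m) - shift_poly w q (orbit_vec w a)) r"
    by (simp add: q')
  have "P * q' = (1 - R) * (\<Sum>i<j. R ^ i) * monom 1 d"
    using \<delta>(1) by (simp add: P_def q'_def mult_ac)
  also have "\<dots> = (1 - R ^ j) * monom 1 d"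
    by (simp add: one_diff_power_eq)
  also have "R ^ j = smult (\<kappa> ^ j) (q ^ j * monom 1 (d * j))"
    by (simp add: R_def smult_power power_mult_distrib monom_power)
  finally have "P * q' = monom 1 d + smult (- (\<kappa> ^ j)) (q ^ j * monom 1 (d * j)) * monom 1 d"
    by (simp add: algebra_simps)
  then have "shift_poly w (P * q') (orbit_vec w m) = orbit_vec w a
      + seq_scale (- (\<kappa> ^ j)) (shift_poly w (q ^ j) (orbit_vec w (a - int (d * j))))"
    by (simp only: shift_poly_add shift_poly_mult shift_poly_monom shift_poly_smult
        weighted_shift_power_orbit_vec[OF nz] d(2))
  then have error: "shift_poly w P (shift_poly w q' (orbit_vec w m)) - orbit_vec w a
      = seq_scale (- (\<kappa> ^ j)) (shift_poly w (q ^ j) (orbit_vec w (a - int (d * j))))"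
    by (simp add: shift_poly_mult)
  \<comment> \<open>The number of steps from the index controlled by the hypothesis down to that of the error; each
      step costs a factor \<open>M\<close>, and there are at most \<open>j (a + 1)\<close> of them.\<close>
  define t where "t = nat (a + 1) * (j - 1)"
  have t: "a - int (d * j) = - int j * (m - A) - 1 - int t"
    using a j by (simp add: t_def A_def d algebra_simps of_nat_diff)
  have "l1_bound (orbit_vec w (- int j * (m - A) - 1)) W"
  proof -
    have "- int j * (m - A) - 1 < 0" using m j by (smt (verit) mult_nonneg_nonneg mult_minus_left of_nat_0_le_iff)
    then have "norm (orbit_coeff w (- int j * (m - A) - 1)) = W"
      by (simp add: norm_orbit_coeff W_def wtilde_def)
    then show ?thesis using l1_bound_basis unfolding orbit_vec_def by metis
  qed
  from l1_bound_shift_power[where w = w, OF M(1) this, of t]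
  have "l1_bound (orbit_vec w (a - int (d * j))) (M ^ t * W)"
    unfolding t weighted_shift_power_orbit_vec[OF nz] .
  moreover have "M ^ t * W \<le> (M ^ nat (a + 1)) ^ j * W"
    using M(2) W0 by (auto simp: t_def simp flip: power_mult intro!: mult_right_mono power_increasing)
  ultimately have "l1_bound (orbit_vec w (a - int (d * j))) ((M ^ nat (a + 1)) ^ j * W)"
    by (rule l1_bound_mono)
  from l1_bound_scale[OF shift_poly_power_bounded[OF K(2) this, of j], of "- (\<kappa> ^ j)"]
  have "l1_bound (shift_poly w P (shift_poly w q' (orbit_vec w m)) - orbit_vec w a)
      (norm (- (\<kappa> ^ j)) * (K ^ j * ((M ^ nat (a + 1)) ^ j * W)))"
    unfolding error .
  moreover have "norm (- (\<kappa> ^ j)) * (K ^ j * ((M ^ nat (a + 1)) ^ j * W)) = (C * \<mu>) ^ j * W"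
    by (simp add: norm_power \<kappa> C_def power_mult_distrib power_divide field_simps)
  ultimately have "l1_bound (shift_poly w P (shift_poly w q' (orbit_vec w m)) - orbit_vec w a)
      ((C * \<mu>) ^ j * W)"
    by (simp only:)
  then have "l1_bound (shift_poly w P (shift_poly w q' (orbit_vec w m)) - orbit_vec w a) \<epsilon>"
    using power_small s(3) by (rule l1_bound_mono[OF _ order_trans])
  with near show ?thesis using that[of m q' P] a m by (simp add: A_def)
qed



text \<open>Besides approximating \<open>u\<^sub>a\<close>, the approximation must survive two operations: a small change of the
  vector, which limits the new radius, and the powers \<open>T\<^bsup>a-k\<^esup>\<close> that lead from \<open>u\<^sub>a\<close> to \<open>u\<^sub>k\<close>.\<close>

lemma approximation_stage:
  fixes w :: "int \<Rightarrow> complex" and N :: nat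
  assumes nz: "\<And>n. w n \<noteq> 0" and M: "\<And>n. norm (w n) \<le> M" "1 \<le> M"
    and small: "vanishing_means w"
    and a: "int N < a" and r: "0 < r"
  obtains m q' r' where "a < m" "0 < r'" "r' \<le> r / 2"
    and "l1_bound (shift_poly w q' (orbit_vec w m) - shift_poly w q (orbit_vec w a)) (r / 2)"
    and "\<And>x k. l1_bound (x - shift_poly w q' (orbit_vec w m)) r' \<Longrightarrow> \<bar>k\<bar> \<le> int N \<Longrightarrow>
      \<exists>z\<in>seq.span (range (\<lambda>n. (weighted_shift w ^^ n) x)). l1_bound (z - orbit_vec w k) (1 / (N + 1))"
proof -
  \<comment> \<open>At most \<open>2 a\<close> steps lead from \<open>u\<^sub>a\<close> to \<open>u\<^sub>k\<close>. The factor 2 leaves room for the second error,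
      which arises from replacing the centre of the ball by \<open>x\<close>.\<close>
  define \<epsilon> where "\<epsilon> = 1 / (2 * (real N + 1) * M ^ nat (2 * a))"
  have \<epsilon>: "0 < \<epsilon>" using M(2) by (simp add: \<epsilon>_def)
  have "1 \<le> a" "0 < r / 2" using a r by auto
  obtain m q' P where m: "a < m"
    and near: "l1_bound (shift_poly w q' (orbit_vec w m) - shift_poly w q (orbit_vec w a)) (r / 2)"
    and hit: "l1_bound (shift_poly w P (shift_poly w q' (orbit_vec w m)) - orbit_vec w a) \<epsilon>"
    by (rule geometric_perturbation[where w = w and q = q, OF nz M small \<open>1 \<le> a\<close> \<open>0 < r / 2\<close> \<epsilon>])
  obtain K where K: "0 < K" "\<And>x s. l1_bound x s \<Longrightarrow> l1_bound (shift_poly w P x) (K * s)"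
    using shift_poly_bounded[where w = w and q = P, OF M(1)] by metis
  define f where "f = shift_poly w q' (orbit_vec w m)"
  define r' where "r' = min (r / 2) (\<epsilon> / K)"
  have r': "0 < r'" using r \<epsilon> K(1) by (simp add: r'_def)
  have half: "r' \<le> r / 2" unfolding r'_def by (rule min.cobounded1)
  have "K * r' \<le> \<epsilon>" using K(1) by (simp add: r'_def min_def field_simps)
  have "\<exists>z\<in>seq.span (range (\<lambda>n. (weighted_shift w ^^ n) x)). l1_bound (z - orbit_vec w k) (1 / (N + 1))"
    if x: "l1_bound (x - f) r'" and k: "\<bar>k\<bar> \<le> int N" for x k
  proof -
    define i where "i = nat (a - k)"
    have i: "a - int i = k" "i \<le> nat (2 * a)" using a k by (auto simp: i_def)
    have "l1_bound (shift_poly w P (x - f) + (shift_poly w P f - orbit_vec w a)) (K * r' + \<epsilon>)"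
      using l1_bound_add[OF K(2)[OF x] hit] by (simp add: f_def)
    then have "l1_bound (shift_poly w P x - orbit_vec w a) (K * r' + \<epsilon>)"
      by (simp add: shift_poly_arg_diff)
    then have "l1_bound (shift_poly w P x - orbit_vec w a) (2 * \<epsilon>)"
      by (rule l1_bound_mono) (use \<open>K * r' \<le> \<epsilon>\<close> in simp)
    from l1_bound_shift_power[where w = w, OF M(1) this, of i]
    have "l1_bound (shift_poly w (monom 1 i) (shift_poly w P x - orbit_vec w a)) (M ^ i * (2 * \<epsilon>))"
      by (simp only: shift_poly_monom)
    moreover have "shift_poly w (monom 1 i) (shift_poly w P x - orbit_vec w a)
        = shift_poly w (monom 1 i * P) x - orbit_vec w k"
      by (simp only: shift_poly_arg_diff shift_poly_mult)
        (simp only: shift_poly_monom weighted_shift_power_orbit_vec[OF nz] i(1))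
    moreover have "M ^ i * (2 * \<epsilon>) \<le> 1 / (N + 1)"
    proof -
      have cancel: "X * (2 * (1 / (2 * c * X))) = 1 / c" if "X \<noteq> 0" for X c :: real
        using that by simp
      have "M ^ i * (2 * \<epsilon>) \<le> M ^ nat (2 * a) * (2 * \<epsilon>)"
        using M(2) \<epsilon> i(2) by (intro mult_right_mono power_increasing) auto
      also have "\<dots> = 1 / (N + 1)"
        using M(2) cancel[of "M ^ nat (2 * a)" "real N + 1"] by (simp add: \<epsilon>_def add.commute)
      finally show ?thesis .
    qed
    ultimately have "l1_bound (shift_poly w (monom 1 i * P) x - orbit_vec w k) (1 / (N + 1))"
      by (metis l1_bound_mono)
    then show ?thesis using shift_poly_span_orbit by blast
  qed
  with m r' half near show ?thesis using that[of m r' q'] by (simp add: f_def)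
qed

text \<open>Iteration of \<open>approximation_stage\<close>. The state of the iteration is a triple \<open>(q, a, r)\<close> standing
  for the ball with centre \<open>q(T) u\<^sub>a\<close> and radius \<open>r\<close>. It starts at the zero vector.\<close>

lemma l1_vector_approximating_orbit_vecs:
  fixes w :: "int \<Rightarrow> complex"
  assumes nz: "\<And>n. w n \<noteq> 0" and M: "\<And>n. norm (w n) \<le> M" "1 \<le> M"
    and small: "vanishing_means w"
  obtains x s where "l1_bound x s"
    and "\<And>k \<epsilon>. 0 < \<epsilon> \<Longrightarrow>
      \<exists>z\<in>seq.span (range (\<lambda>n. (weighted_shift w ^^ n) x)). l1_bound (z - orbit_vec w k) \<epsilon>"
proof -
  define centre where "centre s = shift_poly w (fst s) (orbit_vec w (fst (snd s)))"
    for s :: "complex poly \<times> int \<times> real"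
  define radius where "radius s = snd (snd s)" for s :: "complex poly \<times> int \<times> real"
  define ok where "ok N s \<longleftrightarrow> int N < fst (snd s) \<and> 0 < radius s"
    for N :: nat and s :: "complex poly \<times> int \<times> real"
  define refines where "refines N s s' \<longleftrightarrow>
      l1_bound (centre s' - centre s) (radius s / 2) \<and> radius s' \<le> radius s / 2 \<and>
      (\<forall>x k. l1_bound (x - centre s') (radius s') \<longrightarrow> \<bar>k\<bar> \<le> int N \<longrightarrow>
        (\<exists>z\<in>seq.span (range (\<lambda>n. (weighted_shift w ^^ n) x)). l1_bound (z - orbit_vec w k) (1 / (N + 1))))"
    for N :: nat and s s' :: "complex poly \<times> int \<times> real"
  have start: "ok 0 (0, 1, 1)" by (simp add: ok_def radius_def)
  have "\<exists>s'. ok (Suc N) s' \<and> refines N s s'" if "ok N s" for N s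
  proof -
    obtain q a r where s: "s = (q, a, r)" by (cases s)
    with that have "int N < a" "0 < r" by (auto simp: ok_def radius_def)
    then obtain m q' r' where "a < m" "0 < r'" "r' \<le> r / 2"
      and "l1_bound (shift_poly w q' (orbit_vec w m) - shift_poly w q (orbit_vec w a)) (r / 2)"
      and "\<And>x k. l1_bound (x - shift_poly w q' (orbit_vec w m)) r' \<Longrightarrow> \<bar>k\<bar> \<le> int N \<Longrightarrow>
        \<exists>z\<in>seq.span (range (\<lambda>n. (weighted_shift w ^^ n) x)). l1_bound (z - orbit_vec w k) (1 / (N + 1))"
      using approximation_stage[where w = w and q = q and N = N and a = a and r = r, OF nz M small] by metis
    then have "ok (Suc N) (q', m, r')" "refines N s (q', m, r')"
      using \<open>int N < a\<close> unfolding ok_def refines_def s centre_def radius_def by auto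
    then show ?thesis by blast
  qed
  \<comment> \<open>The extra conjunct fixes the initial state, so that the first ball is centred at 0 and
      \<open>x\<close> lies in \<open>\<ell>\<^sub>1\<close>.\<close>
  then have "\<exists>t. \<forall>N. (ok N (t N) \<and> (N = 0 \<longrightarrow> t N = (0, 1, 1))) \<and> refines N (t N) (t (Suc N))"
    using start by (intro dependent_nat_choice) auto
  then obtain t where t0: "t 0 = (0, 1, 1)" and t: "\<And>N. refines N (t N) (t (Suc N))" by auto
  then obtain x where x: "\<And>N. l1_bound (x - centre (t N)) (radius (t N))"
    using nested_l1_balls[of "\<lambda>N. centre (t N)" "\<lambda>N. radius (t N)"] by (auto simp: refines_def)
  have "l1_bound x 1"
    using x[of 0] by (simp add: t0 centre_def radius_def)
  moreover have "\<exists>z\<in>seq.span (range (\<lambda>n. (weighted_shift w ^^ n) x)). l1_bound (z - orbit_vec w k) \<epsilon>"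
    if "0 < \<epsilon>" for k \<epsilon>
  proof -
    obtain N0 :: nat where N0: "1 / \<epsilon> < N0" using reals_Archimedean2 by blast
    define N where "N = max N0 (nat \<bar>k\<bar>)"
    have "1 / \<epsilon> < N + 1" using N0 by (simp add: N_def)
    then have "1 / (N + 1) \<le> \<epsilon>" using that by (simp add: field_simps)
    moreover have "\<bar>k\<bar> \<le> int N" by (auto simp: N_def)
    ultimately show ?thesis
      using t[of N] x[of "Suc N"] unfolding refines_def by (meson l1_bound_mono)
  qed
  ultimately show ?thesis by (rule that)
qed

section \<open>Density and cyclicity\<close>

lemma restrict_seq_insert:
  assumes "n \<notin> F"
  shows "restrict_seq (insert n F) y = seq_scale (y n) (basis_vec n) + restrict_seq F y"
  using assms by (auto simp: restrict_seq_def seq_scale_def basis_vec_def)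

text \<open>Each basis vector is a multiple of some \<open>u\<^sub>n\<close>.\<close>

lemma finite_support_approximable:
  assumes nz: "\<And>n. w n \<noteq> 0" and S: "seq.subspace S"
    and orbit: "\<And>k \<epsilon>. 0 < \<epsilon> \<Longrightarrow> \<exists>z\<in>S. l1_bound (z - orbit_vec w k) \<epsilon>"
    and F: "finite F" and \<epsilon>: "0 < \<epsilon>"
  shows "\<exists>z\<in>S. l1_bound (restrict_seq F y - z) \<epsilon>"
  using F \<epsilon>
proof (induction F arbitrary: \<epsilon>)
  case empty
  have "l1_bound (restrict_seq {} y - 0) \<epsilon>"
    using empty by (simp add: l1_bound_def restrict_seq_def)
  then show ?case using seq.subspace_0[OF S] by blast
next
  case (insert n F)
  define c where "c = y n / orbit_coeff w n"
  have "orbit_coeff w n \<noteq> 0" by (simp add: orbit_coeff_def nz)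
  then have c: "seq_scale (y n) (basis_vec n) = seq_scale c (orbit_vec w n)"
    by (simp add: c_def orbit_vec_def)
  have "\<exists>z\<in>S. l1_bound (restrict_seq F y - z) (\<epsilon> / 2)"
    by (rule insert.IH) (use insert.prems in simp)
  then obtain z where z: "z \<in> S" "l1_bound (restrict_seq F y - z) (\<epsilon> / 2)" by blast
  obtain u where u: "u \<in> S" "l1_bound (u - orbit_vec w n) (\<epsilon> / 2 / (norm c + 1))"
    using orbit[of "\<epsilon> / 2 / (norm c + 1)" n] insert.prems by (auto simp: add_nonneg_pos)
  have "norm c * (\<epsilon> / 2 / (norm c + 1)) \<le> \<epsilon> / 2"
    using insert.prems by (simp add: divide_simps add_nonneg_pos)
  then have "l1_bound (seq_scale c (orbit_vec w n - u)) (\<epsilon> / 2)"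
    using l1_bound_scale[of _ _ c] u(2) l1_bound_minus_commute l1_bound_mono by blast
  from l1_bound_add[OF this z(2)]
  have "l1_bound (restrict_seq (insert n F) y - (seq_scale c u + z)) \<epsilon>"
    by (simp add: restrict_seq_insert[OF insert.hyps(2)] c seq.scale_right_diff_distrib algebra_simps)
  moreover have "seq_scale c u + z \<in> S"
    using S u(1) z(1) by (simp add: seq.subspace_add seq.subspace_scale)
  ultimately show "\<exists>z\<in>S. l1_bound (restrict_seq (insert n F) y - z) \<epsilon>" by blast
qed

theorem theorem1p3:
  fixes w :: "int \<Rightarrow> complex"
  assumes "bounded (range w)"
    and "\<And>n. w n \<noteq> 0"
    and "\<And>a::int. a \<ge> 1 \<Longrightarrow>
      Inf {inverse (wtilde w 1 m) * wtilde w (- int j * (m - a)) 0 powr (1 / real j) | j m.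
             j \<ge> 1 \<and> m \<ge> a} = 0"
  shows "\<forall>p::ennreal. 1 \<le> p \<longrightarrow> cyclic_on_lp p (weighted_shift w)"
proof (intro allI impI)
  fix p :: ennreal assume p: "1 \<le> p"
  obtain C where C: "\<And>n. norm (w n) \<le> C" using assms(1) by (auto simp: bounded_iff)
  have M: "norm (w n) \<le> max C 1" for n using C[of n] by simp
  have small: "vanishing_means w" by (rule vanishing_meansI) (rule assms(3))
  obtain x s where x: "l1_bound x s"
    and orbit: "\<And>k \<epsilon>. 0 < \<epsilon> \<Longrightarrow>
      \<exists>z\<in>seq.span (range (\<lambda>n. (weighted_shift w ^^ n) x)). l1_bound (z - orbit_vec w k) \<epsilon>"
    using l1_vector_approximating_orbit_vecs[where w = w and M = "max C 1", OF assms(2) M _ small]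
    by (metis max.cobounded2)
  show "cyclic_on_lp p (weighted_shift w)"
    unfolding cyclic_on_lp_def
  proof (rule bexI[of _ x], intro ballI allI impI)
    show "x \<in> lp_space p" by (rule l1_bound_mem_lp[OF x p])
  next
    fix y and \<epsilon> :: real assume y: "y \<in> lp_space p" and "0 < \<epsilon>"
    then have e: "0 < \<epsilon> / 5" by simp
    obtain F where F: "finite F"
      and trunc: "\<And>z. l1_bound (restrict_seq F y - z) (\<epsilon> / 5) \<Longrightarrow> lp_norm p (y - z) \<le> 4 * (\<epsilon> / 5)"
      using lp_norm_truncated_approx[OF p y e] by metis
    obtain z where "z \<in> seq.span (range (\<lambda>n. (weighted_shift w ^^ n) x))"
      and "l1_bound (restrict_seq F y - z) (\<epsilon> / 5)"
      using finite_support_approximable[where w = w, OF assms(2) seq.subspace_span orbit F e] by metis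
    with trunc[of z] \<open>0 < \<epsilon>\<close>
    show "\<exists>z\<in>seq.span (range (\<lambda>n. (weighted_shift w ^^ n) x)). lp_norm p (y - z) < \<epsilon>"
      by (intro bexI[of _ z]) auto
  qed
qed

end
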